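(* Let $k\ge 1$ and $n\ge 2k+2$. Then every extremal graph for $\{S_{k+2},P_{2k+1}\}$ on $n$ vertices (i.e., every $n$-vertex graph containing neither $S_{k+2}$ nor $P_{2k+1}$ as a subgraph and having the maximum possible number of edges among such graphs) has all of its connected components of order at most $2k$.
   Context: Graphs are finite and simple. $S_{k+2}=K_{1,k+1}$ is the star on $k+2$ vertices and $P_{2k+1}$ is the path on $2k+1$ vertices. *)

theory Defs
  imports "Graph_Theory.Graph_Theory"
begin

text \<open>
  A finite simple graph is a symmetric, loop-free, finite
  digraph without parallel arcs (\<open>pair_graph\<close>); every undirected edge \<open>{u, v}\<close> is
  represented by the two arcs \<open>(u, v)\<close> and \<open>(v, u)\<close>.
\<close>

definition undirected_edges :: "'a pair_pre_digraph \<Rightarrow> 'a set set" where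
  "undirected_edges G = (\<lambda>(u, v). {u, v}) ` parcs G"

text \<open>The index is the number of vertices, so \<open>star_graph (m + 1)\<close> is \<open>K\<^bsub>1,m\<^esub>\<close>; its centre is 0.\<close>

definition star_graph :: "nat \<Rightarrow> nat pair_pre_digraph" where
  "star_graph m = \<lparr> pverts = {..<m}, parcs = {0} \<times> {1..<m} \<union> {1..<m} \<times> {0} \<rparr>"

definition path_graph :: "nat \<Rightarrow> nat pair_pre_digraph" where
  "path_graph m = \<lparr> pverts = {..<m},
     parcs = {(i, j). i < m \<and> j < m \<and> (j = Suc i \<or> i = Suc j)} \<rparr>"

lemma complete_bipartite_star_graph: "K\<^bsub>1,m\<^esub> (with_proj (star_graph (Suc m)))"
  unfolding complete_bipartite_digraph_pair_def star_graph_def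
  by (rule conjI, simp, rule exI[of _ "{0}"], rule exI[of _ "{1..<Suc m}"]) auto

lemma pair_graph_path_graph: "pair_graph (path_graph m)"
proof -
  have "finite (parcs (path_graph m))"
    by (rule finite_subset[of _ "{..<m} \<times> {..<m}"]) (auto simp: path_graph_def)
  then show ?thesis
    by unfold_locales (auto simp: path_graph_def symmetric_def sym_def)
qed

definition contains_copy :: "'a pair_pre_digraph \<Rightarrow> 'b pair_pre_digraph \<Rightarrow> bool" where
  "contains_copy G F \<longleftrightarrow>
     (\<exists>H. subgraph H (with_proj G) \<and> digraph_iso (with_proj F) H)"

definition family_free :: "'b pair_pre_digraph set \<Rightarrow> 'a pair_pre_digraph \<Rightarrow> bool" where
  "family_free \<F> G \<longleftrightarrow> (\<forall>F\<in>\<F>. \<not> contains_copy G F)"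

text \<open>
  The competitors \<open>H\<close> range over graphs on the same vertex type as \<open>G\<close>. This is no restriction:
  \<open>G\<close> itself has \<open>n\<close> vertices, so every \<open>n\<close>-vertex graph has an isomorphic copy on that type.
\<close>

definition extremal_graph ::
    "'b pair_pre_digraph set \<Rightarrow> nat \<Rightarrow> 'a pair_pre_digraph \<Rightarrow> bool" where
  "extremal_graph \<F> n G \<longleftrightarrow>
     pair_graph G \<and> card (pverts G) = n \<and> family_free \<F> G \<and>
     (\<forall>H :: 'a pair_pre_digraph. pair_graph H \<and> card (pverts H) = n \<and> family_free \<F> H \<longrightarrow>
        card (undirected_edges H) \<le> card (undirected_edges G))"

definition connected_component_of_graph ::
    "'a pair_pre_digraph \<Rightarrow> ('a, 'a \<times> 'a) pre_digraph \<Rightarrow> bool" where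
  "connected_component_of_graph G C \<longleftrightarrow> pre_digraph.max_subgraph (with_proj G) connected C"

end

theory Submission
  imports Defs
begin

text \<open>
  For \<open>k \<ge> 2\<close>, every \<open>n \<ge> 2k + 2\<close> is a sum of block sizes from \<open>{k + 1..2k}\<close> such that
  \<open>k\<close> times the block size is odd for at most one block. Putting a (nearly) \<open>k\<close>-regular graph on
  each block gives a competitor with \<open>\<lfloor>kn/2\<rfloor>\<close> edges. Hence in an extremal graph all degrees are \<open>k\<close>,
  except that one vertex \<open>v\<close> may have degree \<open>k - 1 \<ge> 2\<close>. In a component of order above \<open>2k\<close>, take a
  longest path; if \<open>v\<close> is an end, a rotation at \<open>v\<close> moves it into the interior. The ends then have
  degree sum \<open>2k\<close>, so if the path had at most \<open>2k\<close> vertices, these would span a cycle, which could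
  be opened to a longer path because the component is connected. For \<open>k = 1\<close> the maximum degree alone
  bounds the components.
\<close>

section \<open>Arc relations, counting arcs, and adding arcs under a degree bound\<close>

text \<open>Unpacks \<open>pair_graph\<close> (see \<open>pair_graph_iff_graph_on\<close>), so that
  neighbourhoods become relational images and reachability becomes \<open>A\<^sup>*\<close>.\<close>

definition graph_on :: "'a set \<Rightarrow> 'a rel \<Rightarrow> bool" where
  "graph_on V A \<longleftrightarrow> finite V \<and> A \<subseteq> V \<times> V \<and> sym A \<and> irrefl A"

text \<open>No vertex set is mentioned, so every list of length at most 1 is a path; hence the bound
  \<open>2 \<le> length xs\<close> in \<open>path_in_subset\<close>.\<close>

definition path_in :: "'a rel \<Rightarrow> 'a list \<Rightarrow> bool" where
  "path_in A xs \<longleftrightarrow> distinct xs \<and> successively (\<lambda>x y. (x, y) \<in> A) xs"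

lemma graph_on_finite: "graph_on V A \<Longrightarrow> finite A"
  unfolding graph_on_def by (meson finite_SigmaI finite_subset)

lemma card_arcs_eq_sum_degree:
  assumes "graph_on V A"
  shows "card A = (\<Sum>x\<in>V. card (A `` {x}))"
proof -
  have "A = Sigma V (\<lambda>x. A `` {x})"
    using assms by (auto simp: graph_on_def)
  moreover have "finite (A `` {x})" for x
    using graph_on_finite[OF assms] by (simp add: finite_Image)
  ultimately show ?thesis
    using assms card_SigmaI[of V "\<lambda>x. A `` {x}"] by (simp add: graph_on_def)
qed

text \<open>Each fibre of the map forgetting direction consists of two opposite arcs. Besides
  translating edge counts, this supplies the parity of \<open>card A\<close> used later.\<close>

lemma card_arcs_eq_twice_card_edges:
  assumes "finite A" "sym A" "irrefl A"
  shows "card A = 2 * card ((\<lambda>(u, v). {u, v}) ` A)"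
proof -
  let ?e = "\<lambda>(u, v). {u, v}"
  have fib: "card {a \<in> A. ?e a = y} = 2" if y: "y \<in> ?e ` A" for y
  proof -
    obtain u v where uv: "(u, v) \<in> A" "y = {u, v}"
      using y by auto
    then have "(v, u) \<in> A" "u \<noteq> v"
      using assms by (auto simp: sym_def irrefl_def)
    with uv have "{a \<in> A. ?e a = y} = {(u, v), (v, u)}"
      by (auto simp: doubleton_eq_iff)
    with \<open>u \<noteq> v\<close> show ?thesis by simp
  qed
  have "card A = (\<Sum>y\<in>?e ` A. card {a \<in> A. ?e a = y})"
    using sum.image_gen[OF assms(1), of "\<lambda>_. 1 :: nat" ?e] by simp
  also have "\<dots> = (\<Sum>y\<in>?e ` A. 2)"
    using fib by (intro sum.cong) auto
  finally show ?thesis by simp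
qed

text \<open>Either two non-adjacent vertices of degree below \<open>k\<close> can be joined, or an edge \<open>xy\<close> is replaced
  by \<open>ux\<close> and \<open>wy\<close>, where \<open>u\<close> and \<open>w\<close> are adjacent vertices of degree below \<open>k\<close>, or \<open>u = w\<close> has degree
  at most \<open>k - 2\<close>.\<close>

lemma exchange_increases_arcs:
  assumes gr: "graph_on V A" and V: "k < card V"
    and deg: "\<And>x. card (A `` {x}) \<le> k" and few: "card A + 2 \<le> k * card V"
  obtains B where "graph_on V B" "\<And>x. card (B `` {x}) \<le> k" "card A < card B"
proof -
  have finV: "finite V" and AV: "A \<subseteq> V \<times> V" and sA: "\<And>x y. (x, y) \<in> A \<Longrightarrow> (y, x) \<in> A"
    and iA: "\<And>x. (x, x) \<notin> A"
    using gr by (auto simp: graph_on_def sym_def irrefl_def)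
  have finA: "finite A" using gr by (rule graph_on_finite)
  have finN: "finite (A `` X)" for X
    using finA by (simp add: finite_Image)
  show thesis
  proof (cases "\<exists>u\<in>V. \<exists>w\<in>V. u \<noteq> w \<and> (u, w) \<notin> A \<and> card (A `` {u}) < k \<and> card (A `` {w}) < k")
    case True
    then obtain u w where uw: "u \<in> V" "w \<in> V" "u \<noteq> w" "(u, w) \<notin> A" "card (A `` {u}) < k" "card (A `` {w}) < k"
      by blast
    define B where "B = insert (u, w) (insert (w, u) A)"
    have "graph_on V B"
      using gr uw by (auto simp: graph_on_def B_def sym_def irrefl_def)
    moreover have "card (B `` {z}) \<le> k" for z
    proof -
      consider "z = u" | "z = w" | "z \<noteq> u" "z \<noteq> w" by blast
      then show ?thesis
      proof cases
        case 1
        then have "B `` {z} = insert w (A `` {u})" using uw by (auto simp: B_def)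
        then show ?thesis using uw finN by (simp add: card_insert_if)
      next
        case 2
        then have "B `` {z} = insert u (A `` {w})" using uw by (auto simp: B_def)
        then show ?thesis using uw finN by (simp add: card_insert_if)
      next
        case 3
        then have "B `` {z} = A `` {z}" by (auto simp: B_def)
        then show ?thesis using deg by simp
      qed
    qed
    moreover have "card A < card B"
      using uw finA by (intro psubset_card_mono) (auto simp: B_def)
    ultimately show thesis by (rule that)
  next
    case False
    then have clique: "(u, w) \<in> A" if "u \<in> V" "w \<in> V" "u \<noteq> w" "card (A `` {u}) < k" "card (A `` {w}) < k" for u w
      using that by blast
    have sumA: "card A = (\<Sum>x\<in>V. card (A `` {x}))"
      using gr by (rule card_arcs_eq_sum_degree)
    obtain u where u: "u \<in> V" "card (A `` {u}) < k"
    proof (rule ccontr)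
      assume "\<not> thesis"
      then have "card A = (\<Sum>x\<in>V. k)"
        unfolding sumA using deg that by (intro sum.cong refl antisym) (auto simp: not_less[symmetric])
      with few show False by (simp add: mult.commute)
    qed
    \<comment> \<open>The degrees fall short of k by at least 2 in total: either a second vertex is
      deficient, and then adjacent to \<open>u\<close> by \<open>clique\<close>, or \<open>u\<close>
      alone carries the whole deficiency.\<close>
    have "\<exists>w\<in>V. card (A `` {w}) < k \<and> (w = u \<and> card (A `` {u}) + 2 \<le> k \<or> (u, w) \<in> A)"
    proof (cases "\<exists>w\<in>V. w \<noteq> u \<and> card (A `` {w}) < k")
      case True
      then show ?thesis using clique u by metis
    next
      case False
      then have "(\<Sum>x\<in>V - {u}. card (A `` {x})) = (\<Sum>x\<in>V - {u}. k)"
        using deg by (intro sum.cong refl antisym) (auto simp: not_less[symmetric])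
      then have "card A = card (A `` {u}) + (card V - 1) * k"
        unfolding sumA using u finV by (simp add: sum.remove[of V u])
      moreover have "k * card V = k + (card V - 1) * k"
        using V by (cases "card V") (auto simp: algebra_simps)
      ultimately show ?thesis using few u by (intro bexI[of _ u]) auto
    qed
    then obtain w where w: "w \<in> V" "card (A `` {w}) < k" "w = u \<and> card (A `` {u}) + 2 \<le> k \<or> (u, w) \<in> A"
      by blast
    have "card (insert u (A `` {u})) < card V"
      using u V finN by (simp add: card_insert_if)
    then obtain x where x: "x \<in> V" "x \<noteq> u" "(u, x) \<notin> A"
      using card_mono[of "insert u (A `` {u})" V] finN by fastforce
    \<comment> \<open>A deficient \<open>x\<close> would be adjacent to \<open>u\<close> by
      \<open>clique\<close>.\<close>
    have degx: "card (A `` {x}) = k"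
      using clique[of u x] x u deg[of x] by (auto simp: le_less)
    \<comment> \<open>Otherwise the k neighbours of \<open>x\<close> fill the closed neighbourhood
      of \<open>w\<close>, which has at most k elements and contains \<open>u\<close>; but
      \<open>x\<close> is not adjacent to \<open>u\<close>.\<close>
    have "\<exists>y. (x, y) \<in> A \<and> y \<noteq> w \<and> (w, y) \<notin> A"
    proof (rule ccontr)
      assume "\<nexists>y. (x, y) \<in> A \<and> y \<noteq> w \<and> (w, y) \<notin> A"
      then have sub: "A `` {x} \<subseteq> insert w (A `` {w})" by auto
      have "card (insert w (A `` {w})) \<le> card (A `` {x})"
        using w degx finN by (simp add: card_insert_if)
      with sub have "A `` {x} = insert w (A `` {w})"
        using finN by (intro card_seteq) auto
      moreover have "u \<in> insert w (A `` {w})" using w(3) sA by auto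
      ultimately show False using x sA by blast
    qed
    then obtain y where y: "(x, y) \<in> A" "y \<noteq> w" "(w, y) \<notin> A" by blast
    have ne: "x \<noteq> w" "y \<noteq> u" "x \<noteq> y" "(x, u) \<notin> A" "(y, w) \<notin> A" "(y, x) \<in> A" "y \<in> V"
      using w(3) x y sA iA AV by auto
    \<comment> \<open>In passing to \<open>B\<close>, \<open>x\<close> trades the neighbour
      \<open>y\<close> for \<open>u\<close> and \<open>y\<close> trades \<open>x\<close> for
      \<open>w\<close>, so only \<open>u\<close> and \<open>w\<close> gain degree; two arcs go and
      four come.\<close>
    define R where "R = {(x, y), (y, x)}"
    define N where "N = {(u, x), (x, u), (w, y), (y, w)}"
    define B where "B = (A - R) \<union> N"
    have "graph_on V B"
      using gr u w x y ne by (auto simp: graph_on_def B_def R_def N_def sym_def irrefl_def)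
    moreover have "card (B `` {z}) \<le> k" for z
    proof -
      consider "z = u" | "z = w" "u \<noteq> w" | "z = x" | "z = y" | "z \<noteq> u" "z \<noteq> w" "z \<noteq> x" "z \<noteq> y" by blast
      then show ?thesis
      proof cases
        case 1
        show ?thesis
        proof (cases "w = u")
          case True
          then have "B `` {z} = insert x (insert y (A `` {u}))"
            using 1 x ne by (auto simp: B_def R_def N_def)
          then show ?thesis using w(3) True finN iA by (auto simp: card_insert_if)
        next
          case False
          then have "B `` {z} = insert x (A `` {u})"
            using 1 x ne by (auto simp: B_def R_def N_def)
          then show ?thesis using u finN by (auto simp: card_insert_if)
        qed
      next
        case 2
        then have "B `` {z} = insert y (A `` {w})"
          using x y ne by (auto simp: B_def R_def N_def)
        then show ?thesis using w finN by (auto simp: card_insert_if)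
      next
        case 3
        then have "B `` {z} = insert u (A `` {x} - {y})"
          using x y ne by (auto simp: B_def R_def N_def)
        moreover have "card (A `` {x} - {y}) < card (A `` {x})"
          using y finN by (intro card_Diff1_less) auto
        ultimately show ?thesis using degx finN by (auto simp: card_insert_if)
      next
        case 4
        then have "B `` {z} = insert w (A `` {y} - {x})"
          using x y ne by (auto simp: B_def R_def N_def)
        moreover have "card (A `` {y} - {x}) < card (A `` {y})"
          using ne finN by (intro card_Diff1_less) auto
        ultimately show ?thesis using deg[of y] finN by (auto simp: card_insert_if)
      next
        case 5
        then have "B `` {z} = A `` {z}" by (auto simp: B_def R_def N_def)
        then show ?thesis using deg by simp
      qed
    qed
    moreover have "card A < card B"
    proof -
      have "card R = 2" "card N = 4"
        using ne x y by (auto simp: R_def N_def)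
      moreover have "R \<subseteq> A" using y ne by (auto simp: R_def)
      moreover have "(A - R) \<inter> N = {}" using x y ne by (auto simp: N_def)
      moreover have "finite R" "finite N" by (auto simp: R_def N_def)
      ultimately have "card B = card A - 2 + 4" "2 \<le> card A"
        using finA card_mono[of A R] by (auto simp: B_def card_Un_disjoint card_Diff_subset)
      then show ?thesis by simp
    qed
    ultimately show thesis by (rule that)
  qed
qed

section \<open>Near-regular competitors with short paths\<close>

text \<open>Among the graphs on \<open>V\<close> with degrees at most k, one with the most arcs
  admits no exchange, so it misses k-regularity by at most one arc end.\<close>

lemma ex_near_regular_graph:
  assumes "finite V" "k < card V"
  shows "\<exists>A. graph_on V A \<and> (\<forall>x. card (A `` {x}) \<le> k) \<and> k * card V \<le> card A + 1"
proof -
  let ?P = "\<lambda>A. graph_on V A \<and> (\<forall>x. card (A `` {x}) \<le> k)"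
  have "?P {}" using assms by (auto simp: graph_on_def sym_def irrefl_def)
  moreover have "card A < Suc (card (V \<times> V))" if "?P A" for A
    using that assms(1) unfolding less_Suc_eq_le by (intro card_mono) (auto simp: graph_on_def)
  ultimately obtain A where A: "?P A" and max: "\<And>B. ?P B \<Longrightarrow> card B \<le> card A"
    using ex_has_greatest_nat[of ?P "{}" card "Suc (card (V \<times> V))"] by blast
  have "k * card V \<le> card A + 1"
  proof (rule ccontr)
    assume "\<not> ?thesis"
    then obtain B where "?P B" "card A < card B"
      using A assms exchange_increases_arcs[of V A k] by (metis add_2_eq_Suc' not_less_eq_eq Suc_eq_plus1)
    with max show False by fastforce
  qed
  with A show ?thesis by blast
qed

text \<open>Consecutive arcs of a path share a vertex, so the path cannot switch between the two
  relations.\<close>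

lemma path_in_Un_disjoint:
  assumes "path_in (A \<union> B) xs" "A \<subseteq> V \<times> V" "B \<subseteq> W \<times> W" "V \<inter> W = {}"
  shows "path_in A xs \<or> path_in B xs"
proof -
  have "successively (\<lambda>x y. (x, y) \<in> A) xs \<or> successively (\<lambda>x y. (x, y) \<in> B) xs"
    if "successively (\<lambda>x y. (x, y) \<in> A \<union> B) xs"
    using that
  proof (induction xs rule: induct_list012)
    case (3 x y zs)
    then show ?case using assms by (cases zs) auto
  qed auto
  then show ?thesis using assms(1) by (auto simp: path_in_def)
qed

lemma path_in_subset:
  assumes "path_in A xs" "A \<subseteq> V \<times> V" "2 \<le> length xs"
  shows "set xs \<subseteq> V"
proof
  fix x assume "x \<in> set xs"
  then obtain i where i: "i < length xs" "x = xs ! i" by (auto simp: in_set_conv_nth)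
  have step: "(xs ! j, xs ! Suc j) \<in> A" if "Suc j < length xs" for j
    using assms(1) that by (auto simp: path_in_def successively_conv_nth)
  show "x \<in> V"
  proof (cases "Suc i < length xs")
    case True then show ?thesis using step[of i] i assms by auto
  next
    case False
    then have "Suc (i - 1) = i" using i assms by simp
    then show ?thesis using step[of "i - 1"] i assms by auto
  qed
qed

lemma ex_near_regular_graph_short_paths:
  assumes "2 \<le> k" "finite V" "k < card V \<and> card V \<le> 2 * k \<or> 2 * k + 2 \<le> card V"
  shows "\<exists>A. graph_on V A \<and> (\<forall>x. card (A `` {x}) \<le> k) \<and> k * card V \<le> card A + 1 \<and>
           (\<forall>xs. path_in A xs \<longrightarrow> length xs \<le> 2 * k)"
  using assms(2,3)
proof (induction "card V" arbitrary: V rule: less_induct)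
  case less
  have block: "\<exists>A. graph_on W A \<and> (\<forall>x. card (A `` {x}) \<le> k) \<and> k * card W \<le> card A + 1 \<and>
           (\<forall>xs. path_in A xs \<longrightarrow> length xs \<le> 2 * k)"
    if W: "finite W" "k < card W" "card W \<le> 2 * k" for W :: "'a set"
  proof -
    obtain A where A: "graph_on W A" "\<forall>x. card (A `` {x}) \<le> k" "k * card W \<le> card A + 1"
      using ex_near_regular_graph[OF W(1,2)] by blast
    have "length xs \<le> 2 * k" if "path_in A xs" for xs
    proof (cases "2 \<le> length xs")
      case True
      then have "set xs \<subseteq> W"
        using path_in_subset that A by (auto simp: graph_on_def)
      then have "card (set xs) \<le> card W" using W by (intro card_mono)
      then show ?thesis using W that by (simp add: path_in_def distinct_card)
    qed (use assms(1) in auto)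
    with A show ?thesis by blast
  qed
  show ?case
  proof (cases "card V \<le> 2 * k")
    case True
    then show ?thesis using block less.prems by auto
  next
    case False
    \<comment> \<open>\<open>k * s\<close> is even for both \<open>s = k + 1\<close> and \<open>s = 2k\<close>, so the split-off block is regular and
      loses no edge to parity.\<close>
    obtain s where s: "k < s" "s \<le> 2 * k" "even (k * s)" "s < card V"
      "k < card V - s \<and> card V - s \<le> 2 * k \<or> 2 * k + 2 \<le> card V - s"
    \<comment> \<open>Removing k + 1 vertices leaves one block if there are at most 3k + 1, and at
      least 3k \<ge> 2k + 2 vertices if there are more than 4k. In between, removing 2k leaves k + 2
      to 2k vertices.\<close>
    proof (cases "card V \<le> 3 * k + 1 \<or> 4 * k < card V")
      case True
      then show thesis using False less.prems assms(1) by (intro that[of "k + 1"]) auto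
    next
      case False
      then show thesis using assms(1) by (intro that[of "2 * k"]) auto
    qed
    obtain S where S: "S \<subseteq> V" "card S = s" "finite S"
      using s less.prems by (meson obtain_subset_with_card_n less_imp_le)
    have cD: "card (V - S) = card V - s" using S by (simp add: card_Diff_subset)
    obtain A where A: "graph_on S A" "\<forall>x. card (A `` {x}) \<le> k" "k * card S \<le> card A + 1"
      "\<forall>xs. path_in A xs \<longrightarrow> length xs \<le> 2 * k"
      using block[of S] S s by auto
    obtain B where B: "graph_on (V - S) B" "\<forall>x. card (B `` {x}) \<le> k" "k * card (V - S) \<le> card B + 1"
      "\<forall>xs. path_in B xs \<longrightarrow> length xs \<le> 2 * k"
      using less.hyps[of "V - S"] cD s less.prems(1) by auto
    have AS: "A \<subseteq> S \<times> S" and BS: "B \<subseteq> (V - S) \<times> (V - S)"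
      using A B by (auto simp: graph_on_def)
    have gr: "graph_on V (A \<union> B)"
      using A(1) B(1) S less.prems(1) by (auto simp: graph_on_def irrefl_def intro: sym_Un)
    have "card ((A \<union> B) `` {x}) \<le> k" for x
    proof (cases "x \<in> S")
      case True
      then have "(A \<union> B) `` {x} = A `` {x}" using BS by auto
      then show ?thesis using A by simp
    next
      case False
      then have "(A \<union> B) `` {x} = B `` {x}" using AS by auto
      then show ?thesis using B by simp
    qed
    moreover have "even (card A)"
      using card_arcs_eq_twice_card_edges[OF graph_on_finite[OF A(1)]] A(1)
      by (simp add: graph_on_def)
    \<comment> \<open>Both sides are even, so the slack of 1 disappears on \<open>S\<close> and only
      that of \<open>B\<close> remains.\<close>
    then have "k * s \<le> card A" using s(3) A(3) S by (auto elim!: evenE)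
    moreover have "card (A \<union> B) = card A + card B"
      using AS BS graph_on_finite[OF A(1)] graph_on_finite[OF B(1)] by (intro card_Un_disjoint) auto
    moreover have "k * card V = k * s + k * card (V - S)"
      using cD s by (simp flip: distrib_left)
    moreover have "length xs \<le> 2 * k" if "path_in (A \<union> B) xs" for xs
      using path_in_Un_disjoint[OF that AS BS] A(4) B(4) by auto
    ultimately show ?thesis using gr B(3) by (intro exI[of _ "A \<union> B"]) auto
  qed
qed


section \<open>Longest paths: closing, opening and rotating\<close>

lemma path_in_rev: "sym A \<Longrightarrow> path_in A xs \<Longrightarrow> path_in A (rev xs)"
  by (auto simp: path_in_def sym_def elim: successively_mono)

text \<open>The path and its closing arc form a cycle, which is cut just before \<open>y\<close> and
  entered from \<open>z\<close>.\<close>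

lemma closed_path_extend:
  assumes "path_in A xs" "(last xs, hd xs) \<in> A" "y \<in> set xs" "(z, y) \<in> A" "z \<notin> set xs"
  obtains ys where "path_in A ys" "set ys = insert z (set xs)"
proof -
  obtain as bs where xs: "xs = as @ y # bs"
    using assms(3) by (meson split_list)
  let ?ys = "z # y # bs @ as"
  have "path_in A ?ys"
    using assms unfolding xs path_in_def
    by (cases "bs = []"; cases "as = []") (auto simp: successively_append_iff successively_Cons)
  moreover have "set ?ys = insert z (set xs)" by (auto simp: xs)
  ultimately show thesis by (rule that)
qed

text \<open>Ore's crossing argument: the neighbours of the first vertex, shifted back by one along the
  path, and the neighbours of the last vertex must share a position.\<close>

lemma path_in_close:
  assumes p: "path_in A xs" and A: "sym A" "irrefl A" and ne: "xs \<noteq> []"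
    and N: "A `` {hd xs} \<subseteq> set xs" "A `` {last xs} \<subseteq> set xs"
    and deg: "length xs \<le> card (A `` {hd xs}) + card (A `` {last xs})"
  obtains ys where "path_in A ys" "set ys = set xs" "(last ys, hd ys) \<in> A"
proof -
  let ?L = "length xs"
  have h: "hd xs = xs ! 0" "last xs = xs ! (?L - 1)"
    using ne by (auto simp: hd_conv_nth last_conv_nth)
  define I where "I = {i. Suc i < ?L \<and> (hd xs, xs ! Suc i) \<in> A}"
  define J where "J = {i. Suc i < ?L \<and> (xs ! i, last xs) \<in> A}"
  have fin: "finite I" "finite J"
    by (auto simp: I_def J_def intro: finite_subset[of _ "{..<?L}"])
  have "A `` {hd xs} \<subseteq> (\<lambda>i. xs ! Suc i) ` I"
  proof
    fix y assume y: "y \<in> A `` {hd xs}"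
    then obtain j where j: "j < ?L" "y = xs ! j" using N by (metis in_set_conv_nth subsetD)
    with y A h have "j \<noteq> 0" by (metis Image_singleton_iff irrefl_def)
    with y j show "y \<in> (\<lambda>i. xs ! Suc i) ` I"
      by (intro image_eqI[of _ _ "j - 1"]) (auto simp: I_def)
  qed
  then have cI: "card (A `` {hd xs}) \<le> card I"
    using surj_card_le[OF fin(1)] by blast
  have "A `` {last xs} \<subseteq> (\<lambda>i. xs ! i) ` J"
  proof
    fix y assume y: "y \<in> A `` {last xs}"
    then obtain j where j: "j < ?L" "y = xs ! j" using N by (metis in_set_conv_nth subsetD)
    with y A h have "j \<noteq> ?L - 1" by (metis Image_singleton_iff irrefl_def)
    with y j A show "y \<in> (\<lambda>i. xs ! i) ` J"
      by (intro image_eqI[of _ _ j]) (auto simp: J_def sym_def)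
  qed
  then have cJ: "card (A `` {last xs}) \<le> card J"
    using surj_card_le[OF fin(2)] by blast
  have "I \<inter> J \<noteq> {}"
  proof
    assume "I \<inter> J = {}"
    then have "card I + card J = card (I \<union> J)" using fin by (simp add: card_Un_disjoint)
    also have "\<dots> \<le> card {..<?L - 1}" by (intro card_mono) (auto simp: I_def J_def)
    finally show False using cI cJ deg ne by (cases xs) auto
  qed
  then obtain i where i: "Suc i < ?L" "(hd xs, xs ! Suc i) \<in> A" "(xs ! i, last xs) \<in> A"
    by (auto simp: I_def J_def)
  \<comment> \<open>Reversing the second part \<open>vs\<close> makes one crossing arc the junction
    and the other the closing arc.\<close>
  define us where "us = take (Suc i) xs"
  define vs where "vs = drop (Suc i) xs"
  have xs: "xs = us @ vs" and nn: "us \<noteq> []" "vs \<noteq> []"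
    using i by (auto simp: us_def vs_def)
  have "hd us = hd xs" "last vs = last xs"
    using nn by (simp_all add: xs)
  moreover have "hd vs = xs ! Suc i" "last us = xs ! i"
    using i by (auto simp: us_def vs_def hd_drop_conv_nth take_Suc_conv_app_nth)
  ultimately have cross: "(hd us, hd vs) \<in> A" "(last us, last vs) \<in> A"
    using i by simp_all
  have "successively (\<lambda>x y. (x, y) \<in> A) (rev vs)"
    using p A(1) unfolding xs by (auto simp: path_in_def successively_append_iff sym_def elim: successively_mono)
  then have "path_in A (us @ rev vs)"
    using p cross(2) nn unfolding path_in_def xs
    by (auto simp: successively_append_iff hd_rev)
  moreover have "set (us @ rev vs) = set xs" by (simp add: xs)
  moreover have "(last (us @ rev vs), hd (us @ rev vs)) \<in> A"
    using cross(1) nn A(1) by (auto simp: last_rev sym_def)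
  ultimately show thesis by (rule that)
qed

text \<open>Posa rotation: the first vertex has a neighbour \<open>y\<close> other than its
  successor. Reversing the stretch before \<open>y\<close> places the first vertex directly in front
  of \<open>y\<close>, hence in the interior.\<close>

lemma path_in_rotate:
  assumes p: "path_in A xs" and A: "sym A" "irrefl A" and ne: "xs \<noteq> []"
    and N: "A `` {hd xs} \<subseteq> set xs" and deg: "2 \<le> card (A `` {hd xs})"
  obtains ys where "path_in A ys" "set ys = set xs" "hd ys \<noteq> hd xs" "last ys \<noteq> hd xs"
proof -
  obtain v ts where xs: "xs = v # ts" using ne by (cases xs) auto
  \<comment> \<open>For empty \<open>ts\<close> the value \<open>hd ts\<close> is unspecified, but
    \<open>{hd ts}\<close> still has one element.\<close>
  have "\<not> A `` {v} \<subseteq> {hd ts}"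
  proof
    assume "A `` {v} \<subseteq> {hd ts}"
    then have "card (A `` {v}) \<le> card {hd ts}" by (intro card_mono) auto
    with deg xs show False by simp
  qed
  then obtain y where y: "(v, y) \<in> A" "y \<noteq> hd ts" by auto
  then have "y \<in> set ts" using N A(2) by (auto simp: xs irrefl_def)
  then obtain as bs where ts: "ts = as @ y # bs" by (meson split_list)
  have nn: "as \<noteq> []" using y ts by auto
  let ?ys = "rev as @ v # y # bs"
  have "successively (\<lambda>x y. (x, y) \<in> A) (rev as)"
    using p A(1) unfolding xs ts by (auto simp: path_in_def successively_append_iff successively_Cons sym_def elim: successively_mono)
  then have "path_in A ?ys"
    using p y nn A(1) unfolding xs ts path_in_def
    by (auto simp: successively_append_iff successively_Cons last_rev sym_def)
  moreover have "set ?ys = set xs" by (auto simp: xs ts)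
  moreover have "hd ?ys \<noteq> hd xs" "last ?ys \<noteq> hd xs"
    using p nn by (auto simp: xs ts path_in_def hd_rev)
  ultimately show thesis by (rule that)
qed

text \<open>The exceptional vertex \<open>v\<close> may have degree below k, but \<open>deg2\<close>
  still allows a rotation that moves it off the ends of a longest path.\<close>

lemma long_path_if_almost_min_degree:
  assumes A: "finite A" "sym A" "irrefl A" and big: "2 * k < card (A\<^sup>* `` {r})"
    and deg2: "\<And>x. x \<in> A\<^sup>* `` {r} \<Longrightarrow> 2 \<le> card (A `` {x})"
    and degk: "\<And>x. x \<in> A\<^sup>* `` {r} \<Longrightarrow> x \<noteq> v \<Longrightarrow> k \<le> card (A `` {x})"
  obtains xs where "path_in A xs" "length xs = 2 * k + 1"
proof -
  define M where "M = A\<^sup>* `` {r}"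
  \<comment> \<open>An infinite set has \<open>card\<close> 0, so the strict lower bound forces
    finiteness.\<close>
  have finM: "finite M" using big card.infinite by (fastforce simp: M_def)
  have closed: "y \<in> M" if "x \<in> M" "(x, y) \<in> A" for x y
    using that by (auto simp: M_def)
  let ?P = "\<lambda>xs. path_in A xs \<and> xs \<noteq> [] \<and> set xs \<subseteq> M"
  have "?P [r]" by (auto simp: path_in_def M_def)
  moreover have "length xs < Suc (card M)" if "?P xs" for xs
    using that card_mono[OF finM, of "set xs"] by (auto simp: path_in_def distinct_card)
  ultimately obtain xs where xs: "?P xs" and max: "\<And>ys. ?P ys \<Longrightarrow> length ys \<le> length xs"
    using ex_has_greatest_nat[of ?P "[r]" length "Suc (card M)"] by blast
  have len: "length ys = length zs" if "set ys = set zs" "path_in A ys" "path_in A zs" for ys zs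
    using that by (metis distinct_card path_in_def)
  \<comment> \<open>Stated for every path on the vertex set of \<open>xs\<close>, since reversal and
    rotation rearrange the list but keep its set and its maximality.\<close>
  have Nhd: "A `` {hd ys} \<subseteq> set ys" if "?P ys" "set ys = set xs" for ys
  proof (rule ccontr)
    assume "\<not> ?thesis"
    then obtain z where z: "(hd ys, z) \<in> A" "z \<notin> set ys" by auto
    then have "?P (z # ys)"
      using that A(2) closed[of "hd ys" z] hd_in_set[of ys]
      by (auto simp: path_in_def successively_Cons sym_def)
    then have "length (z # ys) \<le> length xs" by (rule max)
    then show False using len[of ys xs] that xs by simp
  qed
  have Nlast: "A `` {last ys} \<subseteq> set ys" if "?P ys" "set ys = set xs" for ys
    using Nhd[of "rev ys"] that path_in_rev[OF A(2)] by (auto simp: hd_rev)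
  have "2 * k < length xs"
  proof (rule ccontr)
    assume short: "\<not> 2 * k < length xs"
    have "\<exists>ys. path_in A ys \<and> set ys = set xs \<and> hd ys \<noteq> v \<and> last ys \<noteq> v"
    proof -
      have rot: "\<exists>zs. path_in A zs \<and> set zs = set xs \<and> hd zs \<noteq> v \<and> last zs \<noteq> v"
        if "?P ys" "set ys = set xs" "hd ys = v" for ys
      proof -
        have "2 \<le> card (A `` {hd ys})"
          using deg2[of "hd ys"] that hd_in_set[of ys] by (auto simp: M_def)
        with that path_in_rotate[OF _ A(2,3) _ Nhd[OF that(1,2)]] show ?thesis by metis
      qed
      consider "hd xs = v" | "last xs = v" | "hd xs \<noteq> v" "last xs \<noteq> v" by blast
      then show ?thesis
      proof cases
        case 1 then show ?thesis using rot xs by blast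
      next
        case 2 then show ?thesis using rot[of "rev xs"] xs path_in_rev[OF A(2)] by (auto simp: hd_rev)
      next
        case 3 then show ?thesis using xs by blast
      qed
    qed
    then obtain ys where ys: "path_in A ys" "set ys = set xs" "hd ys \<noteq> v" "last ys \<noteq> v" by blast
    then have P: "?P ys" using xs by auto
    then have "k \<le> card (A `` {hd ys})" "k \<le> card (A `` {last ys})"
      using degk[of "hd ys"] degk[of "last ys"] ys hd_in_set[of ys] last_in_set[of ys] by (auto simp: M_def)
    then have "length ys \<le> card (A `` {hd ys}) + card (A `` {last ys})"
      using short len[of ys xs] ys xs by simp
    then obtain cs where cs: "path_in A cs" "set cs = set ys" "(last cs, hd cs) \<in> A"
      using path_in_close[OF _ A(2,3) _ Nhd Nlast] P ys by metis
    \<comment> \<open>A vertex set closed under arcs that meets the component contains all of it,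
      but the component has more than 2k vertices and the path at most 2k.\<close>
    have "\<not> A `` set xs \<subseteq> set xs"
    proof
      assume "A `` set xs \<subseteq> set xs"
      then have cl: "A\<^sup>* `` set xs = set xs" by (rule Image_closed_trancl)
      have "hd xs \<in> set xs" "(r, hd xs) \<in> A\<^sup>*"
        using xs hd_in_set[of xs] unfolding M_def by blast+
      then have "r \<in> A\<^sup>* `` set xs"
        using A(2) by (meson ImageI sym_rtrancl symD)
      then have "M \<subseteq> set xs" using cl by (auto simp: M_def intro: rtrancl_trans)
      then have "card M \<le> card (set xs)" by (intro card_mono) auto
      also have "\<dots> \<le> length xs" by (rule card_length)
      finally show False using short big by (simp add: M_def)
    qed
    then obtain y z where yz: "y \<in> set cs" "(y, z) \<in> A" "z \<notin> set cs"
      using cs ys by auto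
    then have "(z, y) \<in> A" using A(2) by (simp add: sym_def)
    then obtain ds where ds: "path_in A ds" "set ds = insert z (set cs)"
      using closed_path_extend[OF cs(1,3) yz(1) _ yz(3)] by blast
    then have "?P ds" using yz xs cs ys closed[of y z] by auto
    then have "length ds \<le> length xs" by (rule max)
    moreover have "length ds = Suc (card (set cs))" "length xs = card (set cs)"
      using ds yz(3) xs cs ys by (auto simp: path_in_def distinct_card[symmetric])
    ultimately show False by simp
  qed
  then have "length (take (2 * k + 1) xs) = 2 * k + 1" by simp
  moreover have "path_in A (take (2 * k + 1) xs)"
    using xs append_take_drop_id[of "2 * k + 1" xs] by (metis distinct_take path_in_def successively_append_iff)
  ultimately show thesis using that by blast
qed

section \<open>Forbidden subgraphs as conditions on degrees and lists\<close>

text \<open>Reduces copies to injective arc-preserving vertex maps. \<open>subgraph\<close> forces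
  tail and head of the image to be \<open>fst\<close> and \<open>snd\<close>, so the vertex map
  determines the arc map.\<close>

lemma contains_copy_iff:
  assumes "pair_wf_digraph G" "pair_wf_digraph F"
  shows "contains_copy G F \<longleftrightarrow>
    (\<exists>f. inj_on f (pverts F) \<and> f ` pverts F \<subseteq> pverts G \<and> (\<forall>(u, v)\<in>parcs F. (f u, f v) \<in> parcs G))"
proof
  assume "contains_copy G F"
  then obtain h where h: "pre_digraph.digraph_isomorphism (with_proj F) h"
    "subgraph (app_iso h (with_proj F)) (with_proj G)"
    by (auto simp: contains_copy_def digraph_iso_def)
  have "(iso_verts h u, iso_verts h v) \<in> parcs G" if "(u, v) \<in> parcs F" for u v
  proof -
    let ?a = "iso_arcs h (u, v)"
    have "iso_tail h = fst" "iso_head h = snd" "?a \<in> parcs G"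
      using h(2) that by (auto simp: subgraph_def compatible_def)
    moreover have "iso_verts h u = iso_tail h ?a" "iso_verts h v = iso_head h ?a"
      using h(1) that by (auto simp: pre_digraph.digraph_isomorphism_def)
    ultimately show ?thesis by simp
  qed
  then show "\<exists>f. inj_on f (pverts F) \<and> f ` pverts F \<subseteq> pverts G \<and> (\<forall>(u, v)\<in>parcs F. (f u, f v) \<in> parcs G)"
    using h by (intro exI[of _ "iso_verts h"]) (auto simp: pre_digraph.digraph_isomorphism_def subgraph_def)
next
  assume "\<exists>f. inj_on f (pverts F) \<and> f ` pverts F \<subseteq> pverts G \<and> (\<forall>(u, v)\<in>parcs F. (f u, f v) \<in> parcs G)"
  then obtain f where f: "inj_on f (pverts F)" "f ` pverts F \<subseteq> pverts G"
    "\<forall>(u, v)\<in>parcs F. (f u, f v) \<in> parcs G" by blast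
  let ?h = "\<lparr>iso_verts = f, iso_arcs = map_prod f f, iso_head = snd, iso_tail = fst\<rparr>"
  interpret F: pair_wf_digraph F by fact
  have "inj_on (map_prod f f) (parcs F)"
    using map_prod_inj_on[OF f(1) f(1)] by (rule inj_on_subset) (auto dest: F.wellformed')
  then have iso: "pre_digraph.digraph_isomorphism (with_proj F) ?h"
    using f assms(2) by (auto simp: pre_digraph.digraph_isomorphism_def wf_digraph_wp_iff)
  moreover have "wf_digraph (app_iso ?h (with_proj F))"
    using iso F.wf_digraphI_app_iso by blast
  then have "subgraph (app_iso ?h (with_proj F)) (with_proj G)"
    using f assms(1) by (auto simp: subgraph_def compatible_def wf_digraph_wp_iff)
  ultimately show "contains_copy G F"
    unfolding contains_copy_def digraph_iso_def by blast
qed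

text \<open>The list enumerates the images of 0, ..., m - 1. Since \<open>2 \<le> m\<close>, each
  entry lies on an arc and is therefore a vertex of \<open>G\<close>.\<close>

lemma contains_copy_path_graph_iff:
  assumes "pair_wf_digraph G" "sym (parcs G)" "2 \<le> m"
  shows "contains_copy G (path_graph m) \<longleftrightarrow> (\<exists>xs. path_in (parcs G) xs \<and> length xs = m)"
proof -
  have wf: "pair_wf_digraph (path_graph m)"
    using pair_graph_path_graph[of m] by (simp add: pair_graph_def pair_digraph_def pair_fin_digraph_def)
  show ?thesis unfolding contains_copy_iff[OF assms(1) wf]
  proof
    assume "\<exists>f. inj_on f (pverts (path_graph m)) \<and> f ` pverts (path_graph m) \<subseteq> pverts G \<and>
        (\<forall>(u, v)\<in>parcs (path_graph m). (f u, f v) \<in> parcs G)"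
    then obtain f where f: "inj_on f {..<m}" "\<And>i. Suc i < m \<Longrightarrow> (f i, f (Suc i)) \<in> parcs G"
      by (auto simp: path_graph_def)
    then have "path_in (parcs G) (map f [0..<m])"
      by (auto simp: path_in_def distinct_map successively_conv_nth lessThan_atLeast0)
    then show "\<exists>xs. path_in (parcs G) xs \<and> length xs = m"
      by (intro exI[of _ "map f [0..<m]"]) auto
  next
    assume "\<exists>xs. path_in (parcs G) xs \<and> length xs = m"
    then obtain xs where xs: "path_in (parcs G) xs" "length xs = m" by blast
    have "parcs G \<subseteq> pverts G \<times> pverts G"
      using assms(1) by (auto dest: pair_wf_digraph.in_arcsD1 pair_wf_digraph.in_arcsD2)
    with xs assms(3) have "set xs \<subseteq> pverts G" by (intro path_in_subset[of "parcs G" xs]) auto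
    moreover have "inj_on ((!) xs) {..<m}"
      using xs by (auto simp: path_in_def inj_on_nth)
    ultimately show "\<exists>f. inj_on f (pverts (path_graph m)) \<and> f ` pverts (path_graph m) \<subseteq> pverts G \<and>
        (\<forall>(u, v)\<in>parcs (path_graph m). (f u, f v) \<in> parcs G)"
      using xs assms(2) by (intro exI[of _ "(!) xs"])
        (auto simp: path_graph_def path_in_def successively_conv_nth sym_def subset_iff)
  qed
qed

lemma contains_copy_star_graph_iff:
  assumes "pair_fin_digraph G" "sym (parcs G)" "irrefl (parcs G)" "1 \<le> m"
  shows "contains_copy G (star_graph (Suc m)) \<longleftrightarrow> (\<exists>x. m \<le> card (parcs G `` {x}))"
proof -
  have wf: "pair_wf_digraph (star_graph (Suc m))"
    by unfold_locales (auto simp: star_graph_def)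
  have wfG: "pair_wf_digraph G" using assms(1) by (simp add: pair_fin_digraph_def)
  have finN: "finite (parcs G `` {x})" for x
    using pair_fin_digraph.pair_finite_arcs[OF assms(1)] by (simp add: finite_Image)
  show ?thesis unfolding contains_copy_iff[OF wfG wf]
  proof
    assume "\<exists>f. inj_on f (pverts (star_graph (Suc m))) \<and> f ` pverts (star_graph (Suc m)) \<subseteq> pverts G \<and>
        (\<forall>(u, v)\<in>parcs (star_graph (Suc m)). (f u, f v) \<in> parcs G)"
    then obtain f where f: "inj_on f {..<Suc m}" "\<forall>i\<in>{1..<Suc m}. (f 0, f i) \<in> parcs G"
      by (fastforce simp: star_graph_def)
    then have "f ` {1..<Suc m} \<subseteq> parcs G `` {f 0}" by auto
    moreover have "inj_on f {1..<Suc m}" using f(1) by (rule inj_on_subset) auto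
    ultimately have "card {1..<Suc m} \<le> card (parcs G `` {f 0})"
      using finN by (metis card_image card_mono)
    then show "\<exists>x. m \<le> card (parcs G `` {x})" by auto
  next
    assume "\<exists>x. m \<le> card (parcs G `` {x})"
    then obtain x where "m \<le> card (parcs G `` {x})" by blast
    then obtain T where T: "T \<subseteq> parcs G `` {x}" "card T = m" "finite T"
      by (meson obtain_subset_with_card_n)
    then obtain g where g: "bij_betw g {1..<Suc m} T"
      by (metis bij_betw_iff_card card_atLeastLessThan diff_Suc_1 finite_atLeastLessThan)
    \<comment> \<open>\<open>g\<close> numbers the m chosen leaves from 1, and index 0 is set to the
      centre.\<close>
    define f where "f = g(0 := x)"
    have f0: "f 0 = x" by (simp add: f_def)
    have fg: "f i \<in> T" "f i = g i" if "i \<in> {1..<Suc m}" for i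
      using that g by (auto simp: f_def bij_betw_def)
    have "x \<notin> T" using T assms(3) by (auto simp: irrefl_def)
    moreover have "inj_on f {1..<Suc m}"
      using g fg(2) inj_on_cong[of "{1..<Suc m}" f g] by (simp add: bij_betw_def)
    moreover have ins: "{..<Suc m} = insert 0 {1..<Suc m}" by auto
    ultimately have "inj_on f {..<Suc m}"
      using fg(1) f0 unfolding ins inj_on_insert by auto
    moreover have arc: "(f 0, f i) \<in> parcs G" "(f i, f 0) \<in> parcs G" if "i \<in> {1..<Suc m}" for i
      using fg(1)[OF that] T(1) assms(2) f0 by (auto simp: sym_def)
    moreover have "f i \<in> pverts G" if "i < Suc m" for i
    proof (cases "i = 0")
      case True
      \<comment> \<open>As \<open>1 \<le> m\<close> there is a leaf, and its arc shows that the
        centre is a vertex.\<close>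
      then show ?thesis using arc(1)[of 1] assms(4) pair_wf_digraph.in_arcsD1[OF wfG] by auto
    next
      case False
      then show ?thesis using arc(1)[of i] that pair_wf_digraph.in_arcsD2[OF wfG] by auto
    qed
    ultimately show "\<exists>f. inj_on f (pverts (star_graph (Suc m))) \<and> f ` pverts (star_graph (Suc m)) \<subseteq> pverts G \<and>
        (\<forall>(u, v)\<in>parcs (star_graph (Suc m)). (f u, f v) \<in> parcs G)"
      by (intro exI[of _ f]) (auto simp: star_graph_def)
  qed
qed

lemma pair_graph_iff_graph_on: "pair_graph G \<longleftrightarrow> graph_on (pverts G) (parcs G)"
proof
  assume "pair_graph G"
  then interpret pair_graph G .
  show "graph_on (pverts G) (parcs G)"
    using pair_finite_verts pair_no_loops pair_sym_arcs
    by (fastforce simp: graph_on_def irrefl_def symmetric_def dest: wellformed')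
next
  assume gr: "graph_on (pverts G) (parcs G)"
  then show "pair_graph G"
    using graph_on_finite[OF gr]
    by unfold_locales (auto simp: graph_on_def irrefl_def symmetric_def)
qed

text \<open>\<open>star_graph (k + 2)\<close> has k + 1 leaves, so excluding it bounds all degrees
  by k.\<close>

lemma family_free_star_path_iff:
  assumes "pair_graph G" "1 \<le> k"
  shows "family_free {star_graph (k + 2), path_graph (2 * k + 1)} G \<longleftrightarrow>
    (\<forall>x. card (parcs G `` {x}) \<le> k) \<and> \<not> (\<exists>xs. path_in (parcs G) xs \<and> length xs = 2 * k + 1)"
proof -
  have fin: "pair_fin_digraph G" and wf: "pair_wf_digraph G"
    using assms(1) by (auto simp: pair_graph_def pair_digraph_def pair_fin_digraph_def)
  have "sym (parcs G)" "irrefl (parcs G)"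
    using assms(1) by (auto simp: pair_graph_iff_graph_on graph_on_def)
  then show ?thesis
    using contains_copy_star_graph_iff[OF fin, of "k + 1"] contains_copy_path_graph_iff[OF wf, of "2 * k + 1"] assms(2)
    by (auto simp: family_free_def not_less_eq_eq)
qed

section \<open>Components and the degrees of near-regular graphs\<close>

lemma connected_component_subset_reachable:
  assumes "sym (parcs G)" "connected_component_of_graph G C"
  obtains r where "verts C \<subseteq> (parcs G)\<^sup>* `` {r}"
proof -
  have sub: "subgraph C (with_proj G)" and con: "connected C"
    using assms(2) by (auto simp: connected_component_of_graph_def pre_digraph.max_subgraph_def)
  then obtain r where r: "r \<in> verts C"
    by (auto simp: connected_def strongly_connected_def mk_symmetric_def)
  \<comment> \<open>Symmetrising \<open>C\<close> adds only reversed arcs, which \<open>G\<close>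
    has by symmetry.\<close>
  have "parcs (mk_symmetric C) \<subseteq> parcs G"
    using sub assms(1) by (auto simp: mk_symmetric_def subgraph_def compatible_def sym_def)
  then have mono: "(parcs (mk_symmetric C))\<^sup>* \<subseteq> (parcs G)\<^sup>*" by (rule rtrancl_mono)
  have "(r, x) \<in> (parcs G)\<^sup>*" if "x \<in> verts C" for x
  proof -
    have "r \<rightarrow>\<^sup>*\<^bsub>with_proj (mk_symmetric C)\<^esub> x"
      using con r that by (auto simp: connected_def strongly_connected_def mk_symmetric_def)
    then have "(r, x) \<in> (parcs (mk_symmetric C))\<^sup>*"
      by (auto simp: reachable_def dest: rtrancl_on_rtranclI)
    with mono show ?thesis by blast
  qed
  then show thesis using that by blast
qed

text \<open>Serves the case k = 1: a vertex together with its neighbour, if any, is closed under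
  \<open>A\<close>.\<close>

lemma card_reachable_le_2:
  assumes "finite A" "sym A" "\<And>x. card (A `` {x}) \<le> 1"
  shows "card (A\<^sup>* `` {r}) \<le> 2"
proof -
  have fin: "finite (A `` {x})" for x using assms(1) by (simp add: finite_Image)
  have uniq: "y = z" if "(x, y) \<in> A" "(x, z) \<in> A" for x y z
    using that assms(3)[of x] fin[of x] by (auto simp: card_le_Suc0_iff_eq)
  have "A `` (insert r (A `` {r})) \<subseteq> insert r (A `` {r})"
    using uniq assms(2) by (auto simp: sym_def)
  then have "A\<^sup>* `` (insert r (A `` {r})) = insert r (A `` {r})" by (rule Image_closed_trancl)
  then have "A\<^sup>* `` {r} \<subseteq> insert r (A `` {r})" by blast
  then have "card (A\<^sup>* `` {r}) \<le> card (insert r (A `` {r}))" using fin by (intro card_mono) auto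
  also have "\<dots> \<le> 2" using assms(3)[of r] fin by (simp add: card_insert_if)
  finally show ?thesis .
qed

text \<open>The deficiencies k - deg(x) sum to at most 1, so at most one vertex is deficient, and
  only by 1. For k \<ge> 3 this leaves degree at least 2.\<close>

lemma near_regular_degrees:
  assumes gr: "graph_on V A" and deg: "\<And>x. card (A `` {x}) \<le> k"
    and many: "k * card V \<le> card A + 1" and k: "2 \<le> k"
  obtains v where "\<And>x. x \<in> V \<Longrightarrow> 2 \<le> card (A `` {x})"
    "\<And>x. x \<in> V \<Longrightarrow> x \<noteq> v \<Longrightarrow> k \<le> card (A `` {x})"
proof -
  have finV: "finite V" using gr by (simp add: graph_on_def)
  have total: "card A + (\<Sum>x\<in>V. k - card (A `` {x})) = k * card V"
    unfolding card_arcs_eq_sum_degree[OF gr] sum.distrib[symmetric] using deg by simp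
  with many have def1: "(\<Sum>x\<in>V. k - card (A `` {x})) \<le> 1" by linarith
  have le1: "k - card (A `` {x}) \<le> 1" if "x \<in> V" for x
    using member_le_sum[OF that, of "\<lambda>x. k - card (A `` {x})"] finV def1 by simp
  have two: "2 \<le> card (A `` {x})" if "x \<in> V" for x
  \<comment> \<open>For k = 2 the sum of deficiencies is even, being the difference of two even
    numbers, so it is 0.\<close>
  proof (cases "k = 2")
    case True
    have "even (card A)"
      using card_arcs_eq_twice_card_edges[OF graph_on_finite[OF gr]] gr by (simp add: graph_on_def)
    then have "even (\<Sum>x\<in>V. k - card (A `` {x}))"
      using arg_cong[OF total, of even] True by simp
    then have "(\<Sum>x\<in>V. k - card (A `` {x})) = 0"
      using def1 by (auto simp: le_Suc_eq)
    then show ?thesis using finV that True by auto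
  next
    case False
    then show ?thesis using le1[OF that] k by simp
  qed
  have "\<exists>v. \<forall>x\<in>V. x \<noteq> v \<longrightarrow> k \<le> card (A `` {x})"
  proof (cases "\<exists>v\<in>V. card (A `` {v}) < k")
    case True
    then obtain v where v: "v \<in> V" "card (A `` {v}) < k" by blast
    have "(\<Sum>x\<in>V - {v}. k - card (A `` {x})) = 0"
      using def1 v(2) sum.remove[OF finV v(1), of "\<lambda>x. k - card (A `` {x})"] by linarith
    then show ?thesis using finV by auto
  qed (auto simp: not_less)
  then show thesis using that two by blast
qed

section \<open>Comparing the extremal graph with the competitor\<close>

theorem theorem3p5:
  fixes k n :: nat
    and G :: "'a pair_pre_digraph"
    and C :: "('a, 'a \<times> 'a) pre_digraph"
  assumes "k \<ge> 1"
    and "n \<ge> 2 * k + 2"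
    and "extremal_graph {star_graph (k + 2), path_graph (2 * k + 1)} n G"
    and "connected_component_of_graph G C"
  shows "card (verts C) \<le> 2 * k"
proof -
  let ?F = "{star_graph (k + 2), path_graph (2 * k + 1)}"
  let ?V = "pverts G" and ?A = "parcs G"
  have G: "pair_graph G" and n: "card ?V = n" and free: "family_free ?F G"
    and max: "\<And>H :: 'a pair_pre_digraph. pair_graph H \<Longrightarrow> card (pverts H) = n \<Longrightarrow> family_free ?F H \<Longrightarrow>
        card (undirected_edges H) \<le> card (undirected_edges G)"
    using assms(3) by (auto simp: extremal_graph_def)
  have gr: "graph_on ?V ?A" using G by (simp add: pair_graph_iff_graph_on)
  then have V: "finite ?V" "?A \<subseteq> ?V \<times> ?V" and A: "finite ?A" "sym ?A" "irrefl ?A"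
    using graph_on_finite by (auto simp: graph_on_def)
  have deg: "\<And>x. card (?A `` {x}) \<le> k"
    and nopath: "\<not> (\<exists>xs. path_in ?A xs \<and> length xs = 2 * k + 1)"
    using free family_free_star_path_iff[OF G assms(1)] by auto
  obtain r where r: "verts C \<subseteq> ?A\<^sup>* `` {r}"
    using connected_component_subset_reachable[OF A(2) assms(4)] .
  have finR: "finite (?A\<^sup>* `` {r})"
  proof (rule finite_subset)
    show "?A\<^sup>* `` {r} \<subseteq> insert r (Range ?A)" by (auto elim: rtranclE)
  qed (use A(1) in \<open>simp add: finite_Range\<close>)
  have "card (?A\<^sup>* `` {r}) \<le> 2 * k"
  proof (cases "k = 1")
    case True
    then show ?thesis using card_reachable_le_2[OF A(1,2)] deg by simp
  next
    case False
    then have k: "2 \<le> k" using assms(1) by simp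
    \<comment> \<open>The competitor lives on the vertex set of \<open>G\<close>, so it has the
      right type and order.\<close>
    obtain B where B: "graph_on ?V B" "\<forall>x. card (B `` {x}) \<le> k" "k * card ?V \<le> card B + 1"
      "\<forall>xs. path_in B xs \<longrightarrow> length xs \<le> 2 * k"
      using ex_near_regular_graph_short_paths[OF k V(1)] n assms(2) by auto
    define H where "H = \<lparr>pverts = ?V, parcs = B\<rparr>"
    have H: "pair_graph H" using B(1) by (simp add: pair_graph_iff_graph_on H_def)
    have "family_free ?F H"
      unfolding family_free_star_path_iff[OF H assms(1)] using B by (fastforce simp: H_def)
    then have "card (undirected_edges H) \<le> card (undirected_edges G)"
      using max H n by (simp add: H_def)
    moreover have "card B = 2 * card (undirected_edges H)" "card ?A = 2 * card (undirected_edges G)"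
      using card_arcs_eq_twice_card_edges[OF graph_on_finite[OF B(1)]] B(1) card_arcs_eq_twice_card_edges[OF A]
      by (auto simp: undirected_edges_def H_def graph_on_def)
    ultimately have "k * card ?V \<le> card ?A + 1" using B(3) by simp
    then obtain v where v: "\<And>x. x \<in> ?V \<Longrightarrow> 2 \<le> card (?A `` {x})"
      "\<And>x. x \<in> ?V \<Longrightarrow> x \<noteq> v \<Longrightarrow> k \<le> card (?A `` {x})"
      using near_regular_degrees[OF gr deg _ k] by blast
    show ?thesis
    proof (rule ccontr)
      assume big: "\<not> ?thesis"
      \<comment> \<open>So far \<open>r\<close> is only a starting point of reachability; reaching a
        second vertex gives it an outgoing arc and so places it in \<open>?V\<close>.\<close>
      have "\<not> ?A\<^sup>* `` {r} \<subseteq> {r}"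
      proof
        assume "?A\<^sup>* `` {r} \<subseteq> {r}"
        then have "card (?A\<^sup>* `` {r}) \<le> card {r}" by (intro card_mono) auto
        with big k show False by simp
      qed
      then have "r \<in> ?V" using V(2) by (auto elim: converse_rtranclE)
      then have RV: "?A\<^sup>* `` {r} \<subseteq> ?V" using V(2) by (auto elim: rtranclE)
      obtain xs where "path_in ?A xs" "length xs = 2 * k + 1"
        using long_path_if_almost_min_degree[OF A, of k r v] big v RV by (auto simp: subset_iff not_le)
      with nopath show False by blast
    qed
  qed
  then show ?thesis using card_mono[OF finR r] by simp
qed

end
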